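(* Let $\mathcal{X}$ be a countable state space and, for any $k\in\mathbb{Z}$, let $\{X_n;n\ge k\}$ be an inhomogeneous Markov chain on $\mathcal{X}$ with transition probabilities $P(i,x,j,\cdot)$, $i\le j$ integers, $x\in\mathcal{X}$. Suppose there exist a Borel measurable function $V:\mathcal{X}\to[0,\infty)$ and constants $0<\gamma<1$ and $C>0$ such that for any $x\in\mathcal{X}$ and $n\in\mathbb{Z}$, $$\sum_{y\in\mathcal{X}}V(y)P(n-1,x,n,y)\le\gamma V(x)+C,$$ and that for any $R>0$ the Markov chain $\{X_n;n\ge k\}$ for any $k\in\mathbb{Z}$ is uniformly elliptic on the set $\{x:V(x)\le R\}$. Then there exist a unique invariant measure family $\{\mu_n\}_{n\in\mathbb{Z}}$ for $\{X_n;n\ge k\}$ satisfying $\int_{\mathcal{X}}V(x)\,\mu_n(dx)<+\infty$ for any $n\in\mathbb{Z}$, and constants $0<\alpha<1$ and $\tilde{M}>0$ such that $$\|P(n-m,x,n,\cdot)-\mu_n\|_{TV}\le\tilde{M}\alpha^{m}(1+V(x))$$ for any $n\in\mathbb{Z}$, $m\in\mathbb{N}$ and $x\in\mathcal{X}$.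
   Context: $\mathbb{N}=\{0,1,2,\dots\}$. For a measure $\nu$ on $\mathcal{X}$ write $\nu(x):=\nu(\{x\})$, and $P(n-1,x,n,y):=P(n-1,x,n,\{y\})$. The transition probabilities satisfy $P(i,x,i,\cdot)=\delta_x$ and the Chapman–Kolmogorov equations. Transition operators: $P^{\ast}_{i,j}\nu(\cdot)=\sum_{x\in\mathcal{X}}P(i,x,j,\cdot)\nu(x)$ for probability measures $\nu$ and integers $i\le j$. Invariant measure family: a family $\{\mu_n\}_{n\in\mathbb{Z}}$ of probability measures on $\mathcal{X}$ with $P^{\ast}_{k,i}\mu_k=\mu_i$ for each $k\in\mathbb{Z}$ and $i\ge k$. Uniformly elliptic on a set $A\subset\mathcal{X}$: there exist a Borel probability measure $m$ on $\mathcal{X}$, Borel measurable functions $p_n:\mathcal{X}\times\mathcal{X}\to[0,\infty)$ and a constant $0<\epsilon_0<1$ such that for any $n\in\mathbb{Z}$: (i) $P(n-1,z,n,y)=p_{n-1}(z,y)m(y)$ for any $z,y\in\mathcal{X}$; (ii) $\inf_{z\in\mathcal{X}}\sum_{y\in\mathcal{X}}p_n(x,y)p_{n+1}(y,z)m(y)\ge\epsilon_0$ for any $x\in A$. Total variation norm of a finite signed measure $\mu$: $\|\mu\|_{TV}=\sup\{|\int\phi\,d\mu|:\phi\text{ measurable},\ \sup|\phi|\le 1\}$.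
   Formalization: Uniqueness of the invariant measure family is claimed only among families with finite V-integrals that also satisfy the geometric total variation bound or have V-integrals bounded uniformly in n; among all families with each V-integral finite, uniqueness is false. *)

theory Defs
  imports "HOL-Probability.Probability"
begin

text \<open>
  The countable state space is a type of class \<open>countable\<close> with its discrete
  sigma-algebra, so every function on it (or on its square) is Borel measurable, and a probability
  measure on it is the same thing as a \<open>pmf\<close>.  Sums of nonnegative terms over the state space are
  taken in \<open>[0, \<infinity>]\<close> as integrals against counting measure, so that no sum is silently
  replaced by \<open>0\<close> when it diverges.

  \<open>P i x j\<close> is the law \<open>P(i, x, j, \<cdot>)\<close>; it is only meaningful for \<open>i \<le> j\<close>.
\<close>

type_synonym 'a transition = "int \<Rightarrow> 'a \<Rightarrow> int \<Rightarrow> 'a pmf"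

text \<open>\<open>P\<^sup>*\<^sub>i\<^sub>j \<nu> = (\<Sum>x. P(i, x, j, \<cdot>) \<nu>(x))\<close>.\<close>

definition transition_op :: "'a transition \<Rightarrow> int \<Rightarrow> int \<Rightarrow> 'a pmf \<Rightarrow> 'a pmf" where
  "transition_op P i j \<nu> = bind_pmf \<nu> (\<lambda>x. P i x j)"

text \<open>
  The second condition is Chapman--Kolmogorov,
  \<open>P(i, x, k, \<cdot>) = (\<Sum>y. P(j, y, k, \<cdot>) P(i, x, j, y))\<close>.
\<close>

definition transition_probabilities :: "'a transition \<Rightarrow> bool" where
  "transition_probabilities P \<longleftrightarrow>
     (\<forall>i x. P i x i = return_pmf x) \<and>
     (\<forall>i j k x. i \<le> j \<and> j \<le> k \<longrightarrow> P i x k = transition_op P j k (P i x j))"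

definition invariant_family :: "'a transition \<Rightarrow> (int \<Rightarrow> 'a pmf) \<Rightarrow> bool" where
  "invariant_family P \<mu> \<longleftrightarrow> (\<forall>k i. k \<le> i \<longrightarrow> transition_op P k i (\<mu> k) = \<mu> i)"

definition uniformly_elliptic :: "'a transition \<Rightarrow> 'a set \<Rightarrow> bool" where
  "uniformly_elliptic P A \<longleftrightarrow>
     (\<exists>(m :: 'a pmf) (p :: int \<Rightarrow> 'a \<Rightarrow> 'a \<Rightarrow> real) (\<epsilon>0 :: real).
        (\<forall>n z y. 0 \<le> p n z y) \<and> 0 < \<epsilon>0 \<and> \<epsilon>0 < 1 \<and>
        (\<forall>n.
          (\<forall>z y. pmf (P (n - 1) z n) y = p (n - 1) z y * pmf m y) \<and>
          (\<forall>x\<in>A. (INF z. \<integral>\<^sup>+ y. ennreal (p n x y * p (n + 1) y z * pmf m y) \<partial>count_space UNIV)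
                    \<ge> ennreal \<epsilon>0)))"

text \<open>
  The total variation norm of the signed measure \<open>\<mu> - \<nu>\<close>, as a supremum over test functions
  with values in \<open>[-1, 1]\<close> (so the norm ranges over \<open>[0, 2]\<close>).
\<close>

definition tv_norm_diff :: "'a pmf \<Rightarrow> 'a pmf \<Rightarrow> real" where
  "tv_norm_diff \<mu> \<nu> =
     (SUP \<phi> \<in> {\<phi> :: 'a \<Rightarrow> real. \<forall>x. \<bar>\<phi> x\<bar> \<le> 1}.
        \<bar>(\<integral>x. \<phi> x \<partial>measure_pmf \<mu>) - (\<integral>x. \<phi> x \<partial>measure_pmf \<nu>)\<bar>)"

text \<open>
  Uniqueness cannot be asserted among all invariant families with finite \<open>V\<close>-moments: those
  moments may grow as \<open>n \<rightarrow> -\<infinity>\<close>.  For instance let \<open>V x = 2 ^ x\<close> on the natural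
  numbers, let \<open>m\<close> be the geometric law with weights proportional to \<open>3 powr (- y)\<close>, and
  from \<open>x \<ge> 1\<close> move to \<open>x - 1\<close> with probability \<open>1 - 2 powr (- x)\<close>, otherwise (and
  always from \<open>0\<close>) resample from \<open>m\<close>.  Besides the stationary law there is then the family
  that at times \<open>n \<le> 0\<close> sits at \<open>- n\<close> until its first resampling.  Uniqueness
  therefore refers to families that also satisfy the bound below, or whose \<open>V\<close>-moments are
  bounded in \<open>n\<close>.
\<close>

definition geometrically_attracting :: "'a transition \<Rightarrow> ('a \<Rightarrow> real) \<Rightarrow> (int \<Rightarrow> 'a pmf) \<Rightarrow> bool" where
  "geometrically_attracting P V \<mu> \<longleftrightarrow>
     (\<exists>\<alpha> M :: real. 0 < \<alpha> \<and> \<alpha> < 1 \<and> 0 < M \<and>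
        (\<forall>(n :: int) (m :: nat) x.
           tv_norm_diff (P (n - int m) x n) (\<mu> n) \<le> M * \<alpha> ^ m * (1 + V x)))"

end

theory Submission
  imports Defs
begin

text \<open>
  Ellipticity minorizes the two-step kernels, uniformly in time, by a multiple of a fixed law on
  each sublevel set of \<open>V\<close>.  With \<open>w = 1 + \<beta> V\<close> for a small \<open>\<beta>\<close>, the two-step operator then
  contracts the class of test functions with \<open>h x - h y \<le> L (w x + w y)\<close> (Hairer and Mattingly's
  form of Harris' theorem): if \<open>V x + V y\<close> is large the drift condition gains, otherwise the
  minorization does.  Every test function bounded by 1 belongs to the class with \<open>L = 1\<close>, so the laws
  started at time \<open>n - m\<close> from two points merge geometrically in total variation.  Hence
  \<open>P (n - m) x n\<close> is Cauchy as \<open>m\<close> grows, its limits form the invariant family, and any invariant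
  family with bounded \<open>V\<close>-moments is geometrically attracting.
\<close>

section \<open>Bounded test functions, total variation and mixtures of laws\<close>

lemma integrable_pmf_bounded:
  fixes \<phi> :: "'a \<Rightarrow> real"
  assumes "\<And>x. \<bar>\<phi> x\<bar> \<le> B"
  shows "integrable (measure_pmf p) \<phi>"
  using assms by (intro measure_pmf.integrable_const_bound[where B = B]) auto

lemma abs_integral_pmf_le:
  fixes \<phi> :: "'a \<Rightarrow> real"
  assumes "\<And>x. \<bar>\<phi> x\<bar> \<le> B"
  shows "\<bar>\<integral>x. \<phi> x \<partial>measure_pmf p\<bar> \<le> B"
proof -
  have "\<bar>\<integral>x. \<phi> x \<partial>measure_pmf p\<bar> \<le> (\<integral>x. \<bar>\<phi> x\<bar> \<partial>measure_pmf p)"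
    by (rule integral_abs_bound)
  also have "\<dots> \<le> B"
    using integrable_pmf_bounded[of \<phi>, OF assms] assms
    by (intro measure_pmf.integral_le_const) auto
  finally show ?thesis .
qed

lemma integral_pmf_eq_count_space:
  fixes \<phi> :: "'a \<Rightarrow> real"
  shows "(\<integral>x. \<phi> x \<partial>measure_pmf p) = (\<integral>x. pmf p x * \<phi> x \<partial>count_space UNIV)"
  unfolding measure_pmf_eq_density by (subst integral_density) auto

lemma integrable_pmf_mult_bounded:
  fixes \<phi> :: "'a \<Rightarrow> real"
  assumes "\<And>x. \<bar>\<phi> x\<bar> \<le> B"
  shows "integrable (count_space UNIV) (\<lambda>x. pmf p x * \<phi> x)"
proof -
  have "integrable (density (count_space UNIV) (pmf p)) \<phi>"
    using integrable_pmf_bounded[of \<phi> B p, OF assms] by (simp add: measure_pmf_eq_density)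
  then show ?thesis by (subst (asm) integrable_density) auto
qed

lemma pmf_eq_if_integral_bounded_eq:
  fixes p q :: "'a pmf"
  assumes "\<And>\<phi> :: 'a \<Rightarrow> real. (\<And>x. \<bar>\<phi> x\<bar> \<le> 1) \<Longrightarrow>
    (\<integral>x. \<phi> x \<partial>measure_pmf p) = (\<integral>x. \<phi> x \<partial>measure_pmf q)"
  shows "p = q"
proof (rule pmf_eqI)
  fix i
  show "pmf p i = pmf q i"
    using assms[of "indicator {i}"] by (simp add: pmf.rep_eq split: split_indicator)
qed

lemma tv_norm_diff_leI:
  assumes "\<And>\<phi> :: 'a \<Rightarrow> real. (\<And>x. \<bar>\<phi> x\<bar> \<le> 1) \<Longrightarrow>
    \<bar>(\<integral>x. \<phi> x \<partial>measure_pmf p) - (\<integral>x. \<phi> x \<partial>measure_pmf q)\<bar> \<le> B"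
  shows "tv_norm_diff p q \<le> B"
  unfolding tv_norm_diff_def
proof (rule cSUP_least)
  show "{\<phi> :: 'a \<Rightarrow> real. \<forall>x. \<bar>\<phi> x\<bar> \<le> 1} \<noteq> {}"
    by (auto intro!: exI[of _ "\<lambda>_. 0"])
qed (use assms in auto)

lemma abs_integral_diff_le_tv_norm_diff:
  fixes \<phi> :: "'a \<Rightarrow> real"
  assumes "\<And>x. \<bar>\<phi> x\<bar> \<le> 1"
  shows "\<bar>(\<integral>x. \<phi> x \<partial>measure_pmf p) - (\<integral>x. \<phi> x \<partial>measure_pmf q)\<bar> \<le> tv_norm_diff p q"
  unfolding tv_norm_diff_def
proof (rule cSUP_upper)
  show "bdd_above ((\<lambda>\<phi>. \<bar>(\<integral>x. \<phi> x \<partial>measure_pmf p) - (\<integral>x. \<phi> x \<partial>measure_pmf q)\<bar>) `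
      {\<phi> :: 'a \<Rightarrow> real. \<forall>x. \<bar>\<phi> x\<bar> \<le> 1})"
  proof (rule bdd_aboveI2[where M = 2])
    fix \<phi> :: "'a \<Rightarrow> real" assume "\<phi> \<in> {\<phi>. \<forall>x. \<bar>\<phi> x\<bar> \<le> 1}"
    then have "\<bar>\<integral>x. \<phi> x \<partial>measure_pmf p\<bar> \<le> 1" "\<bar>\<integral>x. \<phi> x \<partial>measure_pmf q\<bar> \<le> 1"
      by (auto intro: abs_integral_pmf_le)
    then show "\<bar>(\<integral>x. \<phi> x \<partial>measure_pmf p) - (\<integral>x. \<phi> x \<partial>measure_pmf q)\<bar> \<le> 2"
      by linarith
  qed
qed (use assms in auto)

lemma integral_bind_pmf_bounded:
  fixes \<phi> :: "'b \<Rightarrow> real"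
  assumes "\<And>x. \<bar>\<phi> x\<bar> \<le> B"
  shows "(\<integral>x. \<phi> x \<partial>measure_pmf (bind_pmf p f)) =
    (\<integral>y. (\<integral>x. \<phi> x \<partial>measure_pmf (f y)) \<partial>measure_pmf p)"
  unfolding measure_pmf_bind
  by (rule integral_bind[where K = "count_space UNIV" and B' = 1 and B = B])
    (use assms in \<open>auto simp: measure_pmf.emeasure_space_1 space_subprob_algebra
      intro!: prob_space_imp_subprob_space measure_pmf.prob_space_axioms\<close>)

section \<open>Completeness in total variation\<close>

text \<open>Testing against signs of differences turns the hypothesis into an l1 bound. Pointwise
  limits then exist, Fatou carries the l1 bound over to them, and
  \<open>\<delta> \<longlonglongrightarrow> 0\<close> prevents any loss of mass. The pointwise
  convergence is also recorded, because moments of the unbounded \<open>V\<close> pass to the limit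
  through it.\<close>

lemma pmf_Cauchy_limit:
  fixes p :: "nat \<Rightarrow> 'a pmf" and \<delta> :: "nat \<Rightarrow> real"
  assumes cauchy: "\<And>m j (\<phi> :: 'a \<Rightarrow> real). (\<And>x. \<bar>\<phi> x\<bar> \<le> 1) \<Longrightarrow>
      \<bar>(\<integral>x. \<phi> x \<partial>measure_pmf (p (m + j))) - (\<integral>x. \<phi> x \<partial>measure_pmf (p m))\<bar> \<le> \<delta> m"
    and lim: "\<delta> \<longlonglongrightarrow> 0"
  obtains q where
    "\<And>m (\<phi> :: 'a \<Rightarrow> real). (\<And>x. \<bar>\<phi> x\<bar> \<le> 1) \<Longrightarrow>
      \<bar>(\<integral>x. \<phi> x \<partial>measure_pmf (p m)) - (\<integral>x. \<phi> x \<partial>measure_pmf q)\<bar> \<le> \<delta> m"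
    "\<And>x. (\<lambda>m. pmf (p m) x) \<longlonglongrightarrow> pmf q x"
proof -
  have l1: "(\<integral>\<^sup>+x. ennreal \<bar>pmf (p m) x - pmf (p (m + j)) x\<bar> \<partial>count_space UNIV) \<le> ennreal (\<delta> m)"
    for m j
  proof -
    \<comment> \<open>Against this sign function the difference of the two integrals equals the l1
      distance of the weights.\<close>
    define \<phi> :: "'a \<Rightarrow> real" where "\<phi> x = sgn (pmf (p (m + j)) x - pmf (p m) x)" for x
    have b: "\<bar>\<phi> x\<bar> \<le> 1" for x by (simp add: \<phi>_def abs_sgn_eq)
    have "integrable (count_space UNIV) (\<lambda>x. \<bar>pmf (p m) x - pmf (p (m + j)) x\<bar>)"
      by (intro integrable_abs Bochner_Integration.integrable_diff integrable_pmf)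
    then have "(\<integral>\<^sup>+x. ennreal \<bar>pmf (p m) x - pmf (p (m + j)) x\<bar> \<partial>count_space UNIV) =
        ennreal (\<integral>x. \<bar>pmf (p m) x - pmf (p (m + j)) x\<bar> \<partial>count_space UNIV)"
      by (intro nn_integral_eq_integral) auto
    also have "(\<integral>x. \<bar>pmf (p m) x - pmf (p (m + j)) x\<bar> \<partial>count_space UNIV) =
        (\<integral>x. pmf (p (m + j)) x * \<phi> x - pmf (p m) x * \<phi> x \<partial>count_space UNIV)"
      by (intro Bochner_Integration.integral_cong) (auto simp: \<phi>_def sgn_if)
    also have "\<dots> = (\<integral>x. \<phi> x \<partial>measure_pmf (p (m + j))) - (\<integral>x. \<phi> x \<partial>measure_pmf (p m))"
      using integrable_pmf_mult_bounded[of \<phi>, OF b] by (simp add: integral_pmf_eq_count_space)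
    also have "\<dots> \<le> \<delta> m"
      using cauchy[of \<phi> m j, OF b] by linarith
    finally show ?thesis by (simp add: ennreal_leI)
  qed
  \<comment> \<open>Nonnegativity is what later allows the comparison of \<open>ennreal\<close>
    values to be read back in the reals.\<close>
  have \<delta>_nonneg: "0 \<le> \<delta> m" for m
    using cauchy[of "\<lambda>_. 0" m 0] by simp
  have "Cauchy (\<lambda>m. pmf (p m) x)" for x
  proof (rule metric_CauchyI)
    fix e :: real assume "0 < e"
    then obtain N where N: "\<delta> N < e / 2"
      using order_tendstoD(2)[OF lim, of "e / 2"] by (auto simp: eventually_sequentially)
    have *: "\<bar>pmf (p m) x - pmf (p N) x\<bar> \<le> \<delta> N" if "m \<ge> N" for m
      using cauchy[of "indicator {x}" N "m - N"] that
      by (simp add: pmf.rep_eq split: split_indicator)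
    show "\<exists>M. \<forall>m\<ge>M. \<forall>n\<ge>M. dist (pmf (p m) x) (pmf (p n) x) < e"
    proof (intro exI allI impI)
      fix m n assume "N \<le> m" "N \<le> n"
      then show "dist (pmf (p m) x) (pmf (p n) x) < e"
        using *[of m] *[of n] N unfolding dist_real_def by linarith
    qed
  qed
  then have "\<forall>x. \<exists>l. (\<lambda>m. pmf (p m) x) \<longlonglongrightarrow> l"
    by (simp add: Cauchy_convergent_iff convergent_def)
  from choice[OF this] obtain f where f: "(\<lambda>m. pmf (p m) x) \<longlonglongrightarrow> f x" for x by blast
  have f_nonneg: "0 \<le> f x" for x
    by (rule LIMSEQ_le_const[OF f]) auto
  \<comment> \<open>Fatou's lemma as \<open>j\<close> tends to infinity with \<open>m\<close>
    fixed.\<close>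
  have l1_lim: "(\<integral>\<^sup>+x. ennreal \<bar>pmf (p m) x - f x\<bar> \<partial>count_space UNIV) \<le> ennreal (\<delta> m)" for m
  proof -
    have "(\<lambda>j. ennreal \<bar>pmf (p m) x - pmf (p (m + j)) x\<bar>) \<longlonglongrightarrow> ennreal \<bar>pmf (p m) x - f x\<bar>" for x
      by (intro tendsto_ennrealI tendsto_intros)
        (rule LIMSEQ_ignore_initial_segment[OF f, of m, unfolded add.commute[of _ m]])
    from lim_imp_Liminf[OF trivial_limit_sequentially this]
    have "(\<integral>\<^sup>+x. ennreal \<bar>pmf (p m) x - f x\<bar> \<partial>count_space UNIV) =
        (\<integral>\<^sup>+x. liminf (\<lambda>j. ennreal \<bar>pmf (p m) x - pmf (p (m + j)) x\<bar>) \<partial>count_space UNIV)"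
      by (simp only:)
    also have "\<dots> \<le> liminf (\<lambda>j. \<integral>\<^sup>+x. ennreal \<bar>pmf (p m) x - pmf (p (m + j)) x\<bar> \<partial>count_space UNIV)"
      by (rule nn_integral_liminf) auto
    also have "\<dots> \<le> liminf (\<lambda>j. ennreal (\<delta> m))"
      by (intro Liminf_mono always_eventually allI l1)
    also have "\<dots> = ennreal (\<delta> m)" by (simp add: Liminf_const)
    finally show ?thesis .
  qed
  \<comment> \<open>The triangle inequality in both directions puts the total mass of
    \<open>f\<close> within \<open>\<delta> m\<close> of 1; letting \<open>m\<close> grow makes
    \<open>f\<close> a probability mass function.\<close>
  have one_le: "1 \<le> (\<integral>\<^sup>+x. ennreal (f x) \<partial>count_space UNIV) + ennreal (\<delta> m)"
    and le_one: "(\<integral>\<^sup>+x. ennreal (f x) \<partial>count_space UNIV) \<le> 1 + ennreal (\<delta> m)" for m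
  proof -
    have "1 = (\<integral>\<^sup>+x. ennreal (pmf (p m) x) \<partial>count_space UNIV)"
      by (simp add: nn_integral_pmf_eq_1)
    also have "\<dots> \<le> (\<integral>\<^sup>+x. ennreal (f x) + ennreal \<bar>pmf (p m) x - f x\<bar> \<partial>count_space UNIV)"
      by (intro nn_integral_mono) (use f_nonneg in \<open>auto simp flip: ennreal_plus intro!: ennreal_leI\<close>)
    also have "\<dots> = (\<integral>\<^sup>+x. ennreal (f x) \<partial>count_space UNIV) +
        (\<integral>\<^sup>+x. ennreal \<bar>pmf (p m) x - f x\<bar> \<partial>count_space UNIV)"
      by (intro nn_integral_add) auto
    also have "\<dots> \<le> (\<integral>\<^sup>+x. ennreal (f x) \<partial>count_space UNIV) + ennreal (\<delta> m)"
      by (intro add_left_mono l1_lim)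
    finally show "1 \<le> (\<integral>\<^sup>+x. ennreal (f x) \<partial>count_space UNIV) + ennreal (\<delta> m)" .
    have "(\<integral>\<^sup>+x. ennreal (f x) \<partial>count_space UNIV) \<le>
        (\<integral>\<^sup>+x. ennreal (pmf (p m) x) + ennreal \<bar>pmf (p m) x - f x\<bar> \<partial>count_space UNIV)"
      by (intro nn_integral_mono) (auto simp flip: ennreal_plus intro!: ennreal_leI)
    also have "\<dots> = (\<integral>\<^sup>+x. ennreal (pmf (p m) x) \<partial>count_space UNIV) +
        (\<integral>\<^sup>+x. ennreal \<bar>pmf (p m) x - f x\<bar> \<partial>count_space UNIV)"
      by (intro nn_integral_add) auto
    also have "\<dots> \<le> 1 + ennreal (\<delta> m)"
      by (intro add_mono l1_lim) (simp add: nn_integral_pmf_eq_1)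
    finally show "(\<integral>\<^sup>+x. ennreal (f x) \<partial>count_space UNIV) \<le> 1 + ennreal (\<delta> m)" .
  qed
  have lim': "(\<lambda>m. ennreal (\<delta> m)) \<longlonglongrightarrow> 0"
    using tendsto_ennrealI[OF lim] by simp
  have f_sum: "(\<integral>\<^sup>+x. ennreal (f x) \<partial>count_space UNIV) = 1"
  proof (rule antisym)
    show "(\<integral>\<^sup>+x. ennreal (f x) \<partial>count_space UNIV) \<le> 1"
      by (rule LIMSEQ_le_const[of "\<lambda>m. 1 + ennreal (\<delta> m)"])
        (use tendsto_add[OF tendsto_const lim', of 1] le_one in auto)
    show "1 \<le> (\<integral>\<^sup>+x. ennreal (f x) \<partial>count_space UNIV)"
      by (rule LIMSEQ_le_const[of "\<lambda>m. (\<integral>\<^sup>+x. ennreal (f x) \<partial>count_space UNIV) + ennreal (\<delta> m)"])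
        (use tendsto_add[OF tendsto_const lim'] one_le in auto)
  qed
  define q where "q = embed_pmf f"
  have pmf_q: "pmf q x = f x" for x
    unfolding q_def by (rule pmf_embed_pmf[OF f_nonneg f_sum])
  show thesis
  proof (rule that[of q])
    show "(\<lambda>m. pmf (p m) x) \<longlonglongrightarrow> pmf q x" for x
      using f by (simp add: pmf_q)
    fix m and \<phi> :: "'a \<Rightarrow> real" assume b: "\<And>x. \<bar>\<phi> x\<bar> \<le> 1"
    have int: "integrable (count_space UNIV) (\<lambda>x. \<bar>pmf (p m) x - pmf q x\<bar>)"
      by (intro integrable_abs Bochner_Integration.integrable_diff integrable_pmf)
    have "(\<integral>x. \<phi> x \<partial>measure_pmf (p m)) - (\<integral>x. \<phi> x \<partial>measure_pmf q) =
        (\<integral>x. pmf (p m) x * \<phi> x - pmf q x * \<phi> x \<partial>count_space UNIV)"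
      using integrable_pmf_mult_bounded[of \<phi>, OF b] by (simp add: integral_pmf_eq_count_space)
    also have "\<bar>\<dots>\<bar> \<le> (\<integral>x. \<bar>pmf (p m) x * \<phi> x - pmf q x * \<phi> x\<bar> \<partial>count_space UNIV)"
      by (rule integral_abs_bound)
    also have "\<dots> \<le> (\<integral>x. \<bar>pmf (p m) x - pmf q x\<bar> \<partial>count_space UNIV)"
    proof (rule integral_mono[OF _ int])
      show "integrable (count_space UNIV) (\<lambda>x. \<bar>pmf (p m) x * \<phi> x - pmf q x * \<phi> x\<bar>)"
        by (intro integrable_abs Bochner_Integration.integrable_diff
            integrable_pmf_mult_bounded[of \<phi>, OF b])
      show "\<bar>pmf (p m) x * \<phi> x - pmf q x * \<phi> x\<bar> \<le> \<bar>pmf (p m) x - pmf q x\<bar>" for x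
        using mult_left_mono[OF b[of x], of "\<bar>pmf (p m) x - pmf q x\<bar>"]
        by (simp add: left_diff_distrib[symmetric] abs_mult)
    qed
    also have "ennreal (\<integral>x. \<bar>pmf (p m) x - pmf q x\<bar> \<partial>count_space UNIV) \<le> ennreal (\<delta> m)"
      using l1_lim[of m] int by (subst nn_integral_eq_integral[symmetric]) (auto simp: pmf_q)
    then have "(\<integral>x. \<bar>pmf (p m) x - pmf q x\<bar> \<partial>count_space UNIV) \<le> \<delta> m"
      using \<delta>_nonneg by (simp add: ennreal_le_iff)
    finally show "\<bar>(\<integral>x. \<phi> x \<partial>measure_pmf (p m)) - (\<integral>x. \<phi> x \<partial>measure_pmf q)\<bar> \<le> \<delta> m" .
  qed
qed

section \<open>Minorization and weighted oscillation\<close>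

lemma nn_integral_pmf_minorization:
  assumes "\<And>z. \<epsilon> * pmf m z \<le> pmf q z" and "0 \<le> \<epsilon>"
  shows "ennreal \<epsilon> * (\<integral>\<^sup>+z. f z \<partial>measure_pmf m) \<le> (\<integral>\<^sup>+z. f z \<partial>measure_pmf q)"
proof -
  have "ennreal \<epsilon> * (\<integral>\<^sup>+z. f z \<partial>measure_pmf m) =
      (\<integral>\<^sup>+z. ennreal \<epsilon> * (ennreal (pmf m z) * f z) \<partial>count_space UNIV)"
    by (simp add: nn_integral_measure_pmf nn_integral_cmult)
  also have "\<dots> \<le> (\<integral>\<^sup>+z. ennreal (pmf q z) * f z \<partial>count_space UNIV)"
    using assms by (intro nn_integral_mono)
      (auto simp: mult.assoc[symmetric] ennreal_mult[symmetric] intro!: mult_right_mono ennreal_leI)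
  finally show ?thesis by (simp add: nn_integral_measure_pmf)
qed

text \<open>
  Both \<open>w - \<psi>\<close> and \<open>w + \<psi>\<close> are nonnegative, so the minorization applies to each; adding the two
  lower bounds eliminates \<open>\<psi>\<close>.
\<close>

lemma minorized_integral_diff_le:
  fixes \<psi> w :: "'a \<Rightarrow> real"
  assumes minor: "\<And>z. \<epsilon> * pmf m z \<le> pmf q1 z" "\<And>z. \<epsilon> * pmf m z \<le> pmf q2 z" "0 \<le> \<epsilon>"
    and bound: "\<And>z. \<bar>\<psi> z\<bar> \<le> w z" "\<And>z. L \<le> w z" "0 \<le> L"
    and int: "integrable (measure_pmf q1) w" "integrable (measure_pmf q2) w"
  shows "(\<integral>z. \<psi> z \<partial>measure_pmf q1) - (\<integral>z. \<psi> z \<partial>measure_pmf q2) \<le>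
    (\<integral>z. w z \<partial>measure_pmf q1) + (\<integral>z. w z \<partial>measure_pmf q2) - 2 * \<epsilon> * L"
proof -
  have int\<psi>: "integrable (measure_pmf q1) \<psi>" "integrable (measure_pmf q2) \<psi>"
    using order_trans[OF bound(1) abs_ge_self]
    by (auto intro!: Bochner_Integration.integrable_bound[OF int(1)]
        Bochner_Integration.integrable_bound[OF int(2)])
  have nn: "0 \<le> w z - \<psi> z" "0 \<le> w z + \<psi> z" for z
    using bound(1)[of z] by auto
  have "ennreal (2 * \<epsilon> * L) = ennreal \<epsilon> * (\<integral>\<^sup>+z. ennreal (2 * L) \<partial>measure_pmf m)"
    using minor(3) bound(3) by (simp add: measure_pmf.emeasure_space_1 ennreal_mult[symmetric] mult_ac)
  also have "\<dots> \<le> ennreal \<epsilon> * (\<integral>\<^sup>+z. ennreal (w z - \<psi> z) + ennreal (w z + \<psi> z) \<partial>measure_pmf m)"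
    by (intro mult_left_mono nn_integral_mono)
      (use nn bound(2) in \<open>auto simp flip: ennreal_plus intro!: ennreal_leI\<close>)
  also have "\<dots> = ennreal \<epsilon> * (\<integral>\<^sup>+z. ennreal (w z - \<psi> z) \<partial>measure_pmf m) +
      ennreal \<epsilon> * (\<integral>\<^sup>+z. ennreal (w z + \<psi> z) \<partial>measure_pmf m)"
    by (subst nn_integral_add) (auto simp: distrib_left)
  also have "\<dots> \<le> (\<integral>\<^sup>+z. ennreal (w z - \<psi> z) \<partial>measure_pmf q1) +
      (\<integral>\<^sup>+z. ennreal (w z + \<psi> z) \<partial>measure_pmf q2)"
    by (intro add_mono nn_integral_pmf_minorization minor)
  also have "\<dots> = ennreal (\<integral>z. w z - \<psi> z \<partial>measure_pmf q1) + ennreal (\<integral>z. w z + \<psi> z \<partial>measure_pmf q2)"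
    using int int\<psi> nn by (simp add: nn_integral_eq_integral)
  also have "\<dots> = ennreal ((\<integral>z. w z - \<psi> z \<partial>measure_pmf q1) + (\<integral>z. w z + \<psi> z \<partial>measure_pmf q2))"
    by (rule ennreal_plus[symmetric]) (auto intro!: integral_nonneg_AE AE_I2 nn)
  finally have "2 * \<epsilon> * L \<le> (\<integral>z. w z - \<psi> z \<partial>measure_pmf q1) + (\<integral>z. w z + \<psi> z \<partial>measure_pmf q2)"
    by (subst (asm) ennreal_le_iff) (auto intro!: integral_nonneg_AE AE_I2 nn add_nonneg_nonneg)
  then show ?thesis using int int\<psi> by simp
qed

text \<open>The hypothesis puts every value of \<open>h - w\<close> below every value of
  \<open>h + w\<close>, so the supremum of the former separates the two. An oscillation bound thus
  becomes a weighted sup-norm bound modulo constants, the form in which the minorization can be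
  applied.\<close>

lemma weighted_oscillation_centre:
  fixes h w :: "'a \<Rightarrow> real"
  assumes "\<And>x y. h x - h y \<le> w x + w y"
  obtains c where "\<And>x. \<bar>h x - c\<bar> \<le> w x"
proof
  define c where "c = (SUP x. h x - w x)"
  have "bdd_above (range (\<lambda>x. h x - w x))"
    by (rule bdd_aboveI2[where M = "h undefined + w undefined"])
      (use assms[of _ undefined] in \<open>simp add: algebra_simps\<close>)
  then have "h x - w x \<le> c" for x
    unfolding c_def by (rule cSUP_upper2[of _ _ x]) auto
  moreover have "c \<le> h x + w x" for x
    unfolding c_def by (rule cSUP_least) (use assms[of _ x] in \<open>auto simp: algebra_simps\<close>)
  ultimately show "\<bar>h x - c\<bar> \<le> w x" for x by (smt (verit))
qed

text \<open>In the Chapman-Kolmogorov sum for two steps the density of the second step contributes a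
  factor \<open>pmf m z\<close> that does not depend on the intermediate state. What remains is the
  sum that ellipticity bounds from below. Both \<open>m\<close> and \<open>\<epsilon>\<close> are
  independent of time.\<close>

lemma uniformly_elliptic_minorization:
  assumes P: "transition_probabilities P" and ell: "uniformly_elliptic P A"
  obtains m :: "'a pmf" and \<epsilon> :: real where "0 < \<epsilon>" "\<epsilon> < 1"
    "\<And>n x z. x \<in> A \<Longrightarrow> \<epsilon> * pmf m z \<le> pmf (P n x (n + 2)) z"
proof -
  obtain m :: "'a pmf" and p \<epsilon> where p: "\<And>n z y. (0::real) \<le> p n z y"
    and \<epsilon>: "0 < \<epsilon>" "\<epsilon> < 1"
    and dens: "\<And>n z y. pmf (P (n - 1) z n) y = p (n - 1) z y * pmf m y"
    and inf: "\<And>n x. x \<in> A \<Longrightarrow>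
      (INF z. \<integral>\<^sup>+ y. ennreal (p n x y * p (n + 1) y z * pmf m y) \<partial>count_space UNIV) \<ge> ennreal \<epsilon>"
    using ell unfolding uniformly_elliptic_def by blast
  show thesis
  proof (rule that[OF \<epsilon>])
    fix n x z assume x: "x \<in> A"
    have "P n x (n + 2) = bind_pmf (P n x (n + 1)) (\<lambda>y. P (n + 1) y (n + 2))"
      using P unfolding transition_probabilities_def transition_op_def by simp
    then have "ennreal (pmf (P n x (n + 2)) z) =
        (\<integral>\<^sup>+y. ennreal (pmf (P n x (n + 1)) y) * ennreal (pmf (P (n + 1) y (n + 2)) z) \<partial>count_space UNIV)"
      by (simp add: ennreal_pmf_bind nn_integral_measure_pmf)
    \<comment> \<open>The step from \<open>n\<close> to \<open>n + 1\<close> has density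
      \<open>p n\<close>, hence the instances of \<open>dens\<close> at \<open>n + 1\<close> and
      \<open>n + 2\<close>.\<close>
    also have "\<dots> = (\<integral>\<^sup>+y. ennreal (p n x y * p (n + 1) y z * pmf m y) * ennreal (pmf m z) \<partial>count_space UNIV)"
      using dens[of "n + 1"] dens[of "n + 2"] p
      by (intro nn_integral_cong) (simp add: ennreal_mult[symmetric] mult_ac add.commute)
    also have "\<dots> = (\<integral>\<^sup>+y. ennreal (p n x y * p (n + 1) y z * pmf m y) \<partial>count_space UNIV) * ennreal (pmf m z)"
      by (rule nn_integral_multc) simp
    also have "\<dots> \<ge> ennreal \<epsilon> * ennreal (pmf m z)"
      by (intro mult_right_mono order_trans[OF inf[OF x, of n]] INF_lower) auto
    finally show "\<epsilon> * pmf m z \<le> pmf (P n x (n + 2)) z"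
      using \<epsilon> by (simp add: ennreal_mult[symmetric])
  qed
qed

section \<open>Drift condition and moment bounds\<close>

locale harris_chain =
  fixes P :: "'a transition" and V :: "'a \<Rightarrow> real" and \<gamma> C :: real
  assumes transition: "transition_probabilities P"
    and V_nonneg: "0 \<le> V x"
    and \<gamma>: "0 < \<gamma>" "\<gamma> < 1" and C_pos: "0 < C"
    and drift: "(\<integral>\<^sup>+y. ennreal (V y) \<partial>measure_pmf (P (n - 1) x n)) \<le> ennreal (\<gamma> * V x + C)"
    and elliptic: "0 < R \<Longrightarrow> uniformly_elliptic P {x. V x \<le> R}"
begin

text \<open>The fixed point of the drift recursion, equal to \<open>C\<close> times the full
  geometric series in \<open>\<gamma>\<close>.\<close>

definition K :: real where "K = C / (1 - \<gamma>)"

lemma K_pos: "0 < K"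
  using \<gamma> C_pos by (simp add: K_def)

lemma K_fixpoint: "\<gamma> * K + C = K"
  using \<gamma> by (simp add: K_def field_simps)

lemma P_refl: "P i x i = return_pmf x"
  using transition by (simp add: transition_probabilities_def)

lemma P_bind: "i \<le> j \<Longrightarrow> j \<le> k \<Longrightarrow> P i x k = bind_pmf (P i x j) (\<lambda>y. P j y k)"
  using transition by (simp add: transition_probabilities_def transition_op_def)

text \<open>Split off the last step and apply the drift condition to it. Since \<open>K\<close> is
  the fixed point of the recursion, the additive constant reproduces itself and does not depend on
  \<open>m\<close>.\<close>

lemma iterated_drift:
  "(\<integral>\<^sup>+y. ennreal (V y) \<partial>measure_pmf (P (n - int m) x n)) \<le> ennreal (\<gamma> ^ m * V x + K)"
proof (induction m arbitrary: n)
  case 0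
  show ?case using K_pos by (simp add: P_refl ennreal_leI)
next
  case (Suc m)
  have eq: "n - int (Suc m) = (n - 1) - int m" by simp
  have pos: "0 \<le> \<gamma> ^ m * V x + K"
    using \<gamma> V_nonneg K_pos by (intro add_nonneg_nonneg mult_nonneg_nonneg) auto
  have "(\<integral>\<^sup>+y. ennreal (V y) \<partial>measure_pmf (P (n - int (Suc m)) x n)) =
      (\<integral>\<^sup>+z. (\<integral>\<^sup>+y. ennreal (V y) \<partial>measure_pmf (P (n - 1) z n)) \<partial>measure_pmf (P (n - 1 - int m) x (n - 1)))"
    unfolding eq by (subst P_bind[of _ "n - 1"]) auto
  also have "\<dots> \<le> (\<integral>\<^sup>+z. ennreal \<gamma> * ennreal (V z) + ennreal C \<partial>measure_pmf (P (n - 1 - int m) x (n - 1)))"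
    using \<gamma> C_pos V_nonneg
    by (intro nn_integral_mono order_trans[OF drift]) (simp add: ennreal_mult[symmetric] ennreal_plus[symmetric] del: ennreal_plus)
  also have "\<dots> = ennreal \<gamma> * (\<integral>\<^sup>+z. ennreal (V z) \<partial>measure_pmf (P (n - 1 - int m) x (n - 1))) + ennreal C"
    by (simp add: nn_integral_add nn_integral_cmult measure_pmf.emeasure_space_1)
  also have "\<dots> \<le> ennreal \<gamma> * ennreal (\<gamma> ^ m * V x + K) + ennreal C"
    by (intro add_right_mono mult_left_mono Suc.IH) simp
  also have "\<dots> = ennreal (\<gamma> * (\<gamma> ^ m * V x + K) + C)"
    using \<gamma> C_pos pos by (simp add: ennreal_mult[symmetric] ennreal_plus[symmetric] del: ennreal_plus)
  also have "\<gamma> * (\<gamma> ^ m * V x + K) + C = \<gamma> ^ Suc m * V x + K"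
    using K_fixpoint by (simp add: algebra_simps)
  finally show ?case .
qed

lemma iterated_drift_uniform:
  "(\<integral>\<^sup>+y. ennreal (V y) \<partial>measure_pmf (P (n - int m) x n)) \<le> ennreal (V x + K)"
proof -
  have "\<gamma> ^ m * V x \<le> V x"
    using \<gamma> V_nonneg by (intro mult_left_le_one_le power_le_one) auto
  then show ?thesis
    by (intro order_trans[OF iterated_drift] ennreal_leI) simp
qed

lemma moment_bound:
  fixes q :: "'a pmf"
  assumes "(\<integral>\<^sup>+y. ennreal (V y) \<partial>measure_pmf q) \<le> ennreal B" and "0 \<le> B"
  shows "integrable (measure_pmf q) V" and "(\<integral>y. V y \<partial>measure_pmf q) \<le> B"
proof -
  show int: "integrable (measure_pmf q) V"
    using assms(1) V_nonneg by (intro integrableI_nonneg) (auto simp: top_unique le_less_trans)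
  show "(\<integral>y. V y \<partial>measure_pmf q) \<le> B"
    using assms int V_nonneg by (simp add: nn_integral_eq_integral ennreal_le_iff)
qed

section \<open>Contraction of test functions\<close>

text \<open>The oscillation constant drops from \<open>L\<close> to \<open>L * a\<close> under two
  steps, with \<open>\<beta>\<close> and \<open>a\<close> the same for all times. The bound of
  \<open>h\<close> by 1 serves integrability and does not enter the constants.\<close>

lemma two_step_contraction:
  obtains \<beta> a where "0 < \<beta>" "0 < a" "a < 1"
    "\<And>n x y (h :: 'a \<Rightarrow> real) L. 0 \<le> L \<Longrightarrow> (\<And>x. \<bar>h x\<bar> \<le> 1) \<Longrightarrow>
      (\<And>x y. h x - h y \<le> L * (1 + \<beta> * V x) + L * (1 + \<beta> * V y)) \<Longrightarrow>
      (\<integral>z. h z \<partial>measure_pmf (P n x (n + 2))) - (\<integral>z. h z \<partial>measure_pmf (P n y (n + 2)))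
        \<le> L * a * (1 + \<beta> * V x) + L * a * (1 + \<beta> * V y)"
proof -
  define g where "g = \<gamma>\<^sup>2"
  have g: "0 < g" "g < 1"
    using \<gamma> by (auto simp: g_def power_less_one_iff)
  \<comment> \<open>\<open>R\<close> is so large that for \<open>V x + V y > R\<close> half of the
    drift gain, \<open>(1 - g) / 2 * (V x + V y)\<close>, exceeds \<open>4 * K\<close>.\<close>
  define R where "R = 8 * K / (1 - g)"
  have "0 < R" using g K_pos by (simp add: R_def)
  then obtain m \<epsilon> where \<epsilon>: "0 < \<epsilon>" "\<epsilon> < 1"
    and minor: "\<And>n x z. V x \<le> R \<Longrightarrow> \<epsilon> * pmf m z \<le> pmf (P n x (n + 2)) z"
    using uniformly_elliptic_minorization[OF transition elliptic[of R]] by (metis mem_Collect_eq)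
  \<comment> \<open>Near the centre the minorization gains \<open>2 * \<epsilon>\<close>, while the
    drift constants of the two points cost \<open>2 * \<beta> * K\<close>. This
    \<open>\<beta>\<close> makes the cost \<open>\<epsilon>\<close>, leaving a net gain
    \<open>\<epsilon>\<close>.\<close>
  define \<beta> where "\<beta> = \<epsilon> / (2 * K)"
  \<comment> \<open>The first entry is the factor for the constant part 2 of the weight, the second
    the factor for its \<open>V\<close> part; it lies halfway between \<open>g\<close> and
    1.\<close>
  define a where "a = max (1 - \<epsilon> / 2) ((1 + g) / 2)"
  have \<beta>: "0 < \<beta>" and \<beta>K: "\<beta> * K = \<epsilon> / 2"
    using \<epsilon> K_pos by (auto simp: \<beta>_def)
  have a: "0 < a" "a < 1" "1 - \<epsilon> / 2 \<le> a" "(1 + g) / 2 \<le> a"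
    using \<epsilon> g by (auto simp: a_def)
  have int: "integrable (measure_pmf (P n x (n + 2))) V"
    and two_step: "(\<integral>z. V z \<partial>measure_pmf (P n x (n + 2))) \<le> g * V x + K" for n x
    using moment_bound[OF iterated_drift[of "n + 2" 2 x]] \<gamma> V_nonneg[of x] K_pos
    by (auto simp: g_def)
  show thesis
  proof (rule that[OF \<beta> a(1,2)])
    fix n x y and h :: "'a \<Rightarrow> real" and L :: real
    assume L: "0 \<le> L" and h: "\<And>x. \<bar>h x\<bar> \<le> 1"
      and osc: "\<And>x y. h x - h y \<le> L * (1 + \<beta> * V x) + L * (1 + \<beta> * V y)"
    obtain c where c: "\<And>x. \<bar>h x - c\<bar> \<le> L * (1 + \<beta> * V x)"
      using weighted_oscillation_centre[of h "\<lambda>x. L * (1 + \<beta> * V x)", OF osc] by blast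
    define W where "W = V x + V y"
    have W: "0 \<le> W" using V_nonneg by (simp add: W_def)
    have int_w: "integrable (measure_pmf (P n x (n + 2))) (\<lambda>z. L * (1 + \<beta> * V z))" for x
      using int by simp
    have w_le: "(\<integral>z. L * (1 + \<beta> * V z) \<partial>measure_pmf (P n x (n + 2))) \<le> L * (1 + \<beta> * (g * V x + K))" for x
      using two_step[where n = n and x = x] int[where n = n and x = x] L \<beta>
      by (simp add: measure_pmf.prob_space mult_left_mono)
    have L_le: "L \<le> L * (1 + \<beta> * V z)" for z
      using L \<beta> V_nonneg[of z] by (simp add: distrib_left)
    \<comment> \<open>One estimate for both cases: \<open>\<eta> = 0\<close> when \<open>W\<close>
      is large and only drift is available, \<open>\<eta> = \<epsilon>\<close> when both points lie
      in the sublevel set.\<close>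
    have diff: "(\<integral>z. h z \<partial>measure_pmf (P n x (n + 2))) - (\<integral>z. h z \<partial>measure_pmf (P n y (n + 2)))
        \<le> L * (2 - 2 * \<eta> + \<beta> * g * W + 2 * \<beta> * K)"
      if \<eta>: "0 \<le> \<eta>" "\<And>z. \<eta> * pmf m z \<le> pmf (P n x (n + 2)) z" "\<And>z. \<eta> * pmf m z \<le> pmf (P n y (n + 2)) z" for \<eta>
    proof -
      \<comment> \<open>Centring by \<open>c\<close> leaves the difference unchanged, since both
        laws have mass 1.\<close>
      have "(\<integral>z. h z - c \<partial>measure_pmf (P n x (n + 2))) - (\<integral>z. h z - c \<partial>measure_pmf (P n y (n + 2)))
          \<le> L * (1 + \<beta> * (g * V x + K)) + L * (1 + \<beta> * (g * V y + K)) - 2 * \<eta> * L"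
        using minorized_integral_diff_le[OF \<eta>(2,3,1) c L_le L int_w int_w] w_le[of x] w_le[of y]
        by linarith
      then show ?thesis
        using integrable_pmf_bounded[of h 1, OF h]
        by (simp add: measure_pmf.prob_space W_def algebra_simps)
    qed
    have "(\<integral>z. h z \<partial>measure_pmf (P n x (n + 2))) - (\<integral>z. h z \<partial>measure_pmf (P n y (n + 2)))
        \<le> L * (a * (2 + \<beta> * W))"
    proof (cases "R < W")
      case True
      then have "8 * K \<le> W * (1 - g)" using g by (simp add: R_def field_simps)
      then have "2 * K \<le> W * ((1 + g) / 2 - g) - 2 * K" by (simp add: field_simps)
      also have "\<dots> \<le> W * (a - g) - 2 * K"
        using a W by (intro diff_right_mono mult_left_mono) auto
      finally have "\<beta> * (2 * K) \<le> \<beta> * (W * (a - g) - 2 * K)"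
        using \<beta> by (intro mult_left_mono) auto
      \<comment> \<open>The gain is at least \<open>4 * \<beta> * K\<close>. One half pays for the
        drift constants; the other equals \<open>\<epsilon>\<close> and covers
        \<open>2 * (1 - a)\<close>.\<close>
      then have "2 + \<beta> * g * W + 2 * \<beta> * K \<le> a * (2 + \<beta> * W)"
        using \<beta>K a by (simp add: algebra_simps)
      then show ?thesis
        using diff[of 0] L by (intro order_trans[OF diff[of 0]] mult_left_mono) auto
    next
      case False
      then have "V x \<le> R" "V y \<le> R"
        using V_nonneg[of x] V_nonneg[of y] by (auto simp: W_def)
      moreover have "2 - 2 * \<epsilon> + \<beta> * g * W + 2 * \<beta> * K \<le> a * (2 + \<beta> * W)"
      proof -
        have "g * (\<beta> * W) \<le> a * (\<beta> * W)"
          using a g \<beta> W by (intro mult_right_mono) auto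
        then show ?thesis using a \<beta>K by (simp add: algebra_simps)
      qed
      ultimately show ?thesis
        using minor \<epsilon> L by (intro order_trans[OF diff[of \<epsilon>]] mult_left_mono) auto
    qed
    also have "L * (a * (2 + \<beta> * W)) = L * a * (1 + \<beta> * V x) + L * a * (1 + \<beta> * V y)"
      by (simp add: W_def algebra_simps)
    finally show "(\<integral>z. h z \<partial>measure_pmf (P n x (n + 2))) - (\<integral>z. h z \<partial>measure_pmf (P n y (n + 2)))
        \<le> L * a * (1 + \<beta> * V x) + L * a * (1 + \<beta> * V y)" .
  qed
qed

text \<open>A test function bounded by 1 oscillates by at most 2, so it belongs to the class with
  \<open>L = 1\<close>. Iterating the two-step contraction gives the factor
  \<open>a ^ (m div 2)\<close>.\<close>

lemma geometric_contraction:
  obtains \<alpha> M where "0 < \<alpha>" "\<alpha> < 1" "0 < M"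
    "\<And>m n x y (\<phi> :: 'a \<Rightarrow> real). (\<And>x. \<bar>\<phi> x\<bar> \<le> 1) \<Longrightarrow>
      \<bar>(\<integral>z. \<phi> z \<partial>measure_pmf (P (n - int m) x n)) - (\<integral>z. \<phi> z \<partial>measure_pmf (P (n - int m) y n))\<bar>
        \<le> M * \<alpha> ^ m * (2 + V x + V y)"
proof -
  obtain \<beta> a where \<beta>: "0 < \<beta>" and a: "0 < a" "a < 1" and step:
    "\<And>n x y (h :: 'a \<Rightarrow> real) L. 0 \<le> L \<Longrightarrow> (\<And>x. \<bar>h x\<bar> \<le> 1) \<Longrightarrow>
      (\<And>x y. h x - h y \<le> L * (1 + \<beta> * V x) + L * (1 + \<beta> * V y)) \<Longrightarrow>
      (\<integral>z. h z \<partial>measure_pmf (P n x (n + 2))) - (\<integral>z. h z \<partial>measure_pmf (P n y (n + 2)))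
        \<le> L * a * (1 + \<beta> * V x) + L * a * (1 + \<beta> * V y)"
    using two_step_contraction by blast
  have iter: "(\<integral>z. \<phi> z \<partial>measure_pmf (P (n - int m) x n)) - (\<integral>z. \<phi> z \<partial>measure_pmf (P (n - int m) y n))
      \<le> a ^ (m div 2) * (1 + \<beta> * V x) + a ^ (m div 2) * (1 + \<beta> * V y)"
    if \<phi>: "\<And>x. \<bar>\<phi> x\<bar> \<le> 1" for m n x y and \<phi> :: "'a \<Rightarrow> real"
  proof (induction m arbitrary: x y rule: less_induct)
    case (less m)
    show ?case
    proof (cases "m < 2")
      case True
      have "0 \<le> \<beta> * V x" "0 \<le> \<beta> * V y" using \<beta> V_nonneg by auto
      then show ?thesis
        using True abs_integral_pmf_le[of \<phi> 1 "P (n - int m) x n", OF \<phi>]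
          abs_integral_pmf_le[of \<phi> 1 "P (n - int m) y n", OF \<phi>] by (simp add: abs_le_iff)
    next
      case False
      define k where "k = m - 2"
      have m: "m = k + 2" using False by (simp add: k_def)
      \<comment> \<open>The two earliest steps are split off. The inner integral, as a function of
        \<open>u\<close>, is bounded by 1 and by induction lies in the class with
        \<open>L = a ^ (k div 2)\<close>.\<close>
      have comp: "(\<integral>z. \<phi> z \<partial>measure_pmf (P (n - int m) x n)) =
          (\<integral>u. (\<integral>z. \<phi> z \<partial>measure_pmf (P (n - int k) u n)) \<partial>measure_pmf (P (n - int m) x (n - int m + 2)))" for x
        using P_bind[of "n - int m" "n - int k" n x] by (simp add: m integral_bind_pmf_bounded[OF \<phi>])
      show ?thesis
        unfolding comp using step[where L = "a ^ (k div 2)" and n = "n - int m" and x = x and y = y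
            and h = "\<lambda>u. \<integral>z. \<phi> z \<partial>measure_pmf (P (n - int k) u n)"]
          less.IH[of k] a abs_integral_pmf_le[of \<phi> 1, OF \<phi>] by (simp add: m mult.commute)
    qed
  qed
  define \<alpha> where "\<alpha> = sqrt a"
  \<comment> \<open>Division by \<open>\<alpha>\<close> accounts for the step lost when
    \<open>m\<close> is odd; \<open>max 1 \<beta>\<close> replaces the weight
    \<open>1 + \<beta> * V\<close> by \<open>1 + V\<close>.\<close>
  define M where "M = max 1 \<beta> / \<alpha>"
  have \<alpha>: "0 < \<alpha>" "\<alpha> < 1" using a by (auto simp: \<alpha>_def)
  have M: "0 < M" using \<alpha> by (simp add: M_def)
  have rate: "a ^ (m div 2) * (1 + \<beta> * V x) + a ^ (m div 2) * (1 + \<beta> * V y) \<le> M * \<alpha> ^ m * (2 + V x + V y)"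
    for m x y
  proof -
    have "a ^ (m div 2) = \<alpha> ^ (2 * (m div 2))" using a by (simp add: \<alpha>_def power_mult)
    then have "a ^ (m div 2) * \<alpha> = \<alpha> ^ (2 * (m div 2) + 1)" by simp
    also have "\<dots> \<le> \<alpha> ^ m" using \<alpha> by (intro power_decreasing) auto
    finally have "a ^ (m div 2) \<le> \<alpha> ^ m / \<alpha>" using \<alpha> by (simp add: field_simps)
    moreover have "1 + \<beta> * V z \<le> max 1 \<beta> * (1 + V z)" for z
      using mult_right_mono[OF max.cobounded2[of \<beta> 1] V_nonneg[of z]] by (simp add: distrib_left add_mono)
    then have "(1 + \<beta> * V x) + (1 + \<beta> * V y) \<le> max 1 \<beta> * (1 + V x) + max 1 \<beta> * (1 + V y)"
      by (intro add_mono)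
    ultimately have "a ^ (m div 2) * ((1 + \<beta> * V x) + (1 + \<beta> * V y))
        \<le> \<alpha> ^ m / \<alpha> * (max 1 \<beta> * (1 + V x) + max 1 \<beta> * (1 + V y))"
      using \<alpha> \<beta> V_nonneg by (intro mult_mono) auto
    also have "\<dots> = \<alpha> ^ m / \<alpha> * (max 1 \<beta> * (2 + V x + V y))"
      by (simp only: distrib_left[symmetric]) simp
    also have "\<dots> = M * \<alpha> ^ m * (2 + V x + V y)"
      by (simp add: M_def)
    finally show ?thesis by (simp only: distrib_left)
  qed
  show thesis
  proof (rule that[OF \<alpha> M])
    fix m n x y and \<phi> :: "'a \<Rightarrow> real" assume \<phi>: "\<And>x. \<bar>\<phi> x\<bar> \<le> 1"
    show "\<bar>(\<integral>z. \<phi> z \<partial>measure_pmf (P (n - int m) x n)) - (\<integral>z. \<phi> z \<partial>measure_pmf (P (n - int m) y n))\<bar>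
        \<le> M * \<alpha> ^ m * (2 + V x + V y)"
      using iter[of \<phi> n m x y, OF \<phi>] iter[of \<phi> n m y x, OF \<phi>] rate[of m x y] by linarith
  qed
qed

text \<open>Averaging the two-point bound over the starting law \<open>q\<close> replaces
  \<open>V y\<close> by its mean. The constants are fixed before \<open>q\<close> and
  \<open>B\<close>. It is applied with \<open>q\<close> a member of an invariant family, and with
  \<open>q\<close> the law of a chain started earlier.\<close>

lemma geometric_contraction_mixture:
  obtains \<alpha> M where "0 < \<alpha>" "\<alpha> < 1" "0 < M"
    "\<And>m n x B (q :: 'a pmf) (\<phi> :: 'a \<Rightarrow> real). (\<And>x. \<bar>\<phi> x\<bar> \<le> 1) \<Longrightarrow> 0 \<le> B \<Longrightarrow>
      (\<integral>\<^sup>+y. ennreal (V y) \<partial>measure_pmf q) \<le> ennreal B \<Longrightarrow>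
      \<bar>(\<integral>z. \<phi> z \<partial>measure_pmf (bind_pmf q (\<lambda>y. P (n - int m) y n))) -
        (\<integral>z. \<phi> z \<partial>measure_pmf (P (n - int m) x n))\<bar> \<le> M * \<alpha> ^ m * (2 + V x + B)"
proof -
  obtain \<alpha> M where \<alpha>: "0 < \<alpha>" "\<alpha> < 1" and M: "0 < M" and contr:
    "\<And>m n x y (\<phi> :: 'a \<Rightarrow> real). (\<And>x. \<bar>\<phi> x\<bar> \<le> 1) \<Longrightarrow>
      \<bar>(\<integral>z. \<phi> z \<partial>measure_pmf (P (n - int m) x n)) - (\<integral>z. \<phi> z \<partial>measure_pmf (P (n - int m) y n))\<bar>
        \<le> M * \<alpha> ^ m * (2 + V x + V y)"
    using geometric_contraction by blast
  show thesis
  proof (rule that[OF \<alpha> M])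
    fix m n x B and q :: "'a pmf" and \<phi> :: "'a \<Rightarrow> real"
    assume \<phi>: "\<And>x. \<bar>\<phi> x\<bar> \<le> 1" and B: "0 \<le> B" "(\<integral>\<^sup>+y. ennreal (V y) \<partial>measure_pmf q) \<le> ennreal B"
    define g where "g y = (\<integral>z. \<phi> z \<partial>measure_pmf (P (n - int m) y n))" for y
    have int_g: "integrable (measure_pmf q) g"
      by (rule integrable_pmf_bounded[of _ 1]) (simp add: g_def abs_integral_pmf_le \<phi>)
    have "(\<integral>z. \<phi> z \<partial>measure_pmf (bind_pmf q (\<lambda>y. P (n - int m) y n))) - g x =
        (\<integral>y. g y - g x \<partial>measure_pmf q)"
      using int_g by (simp add: integral_bind_pmf_bounded[OF \<phi>] g_def[symmetric] measure_pmf.prob_space)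
    also have "\<bar>\<dots>\<bar> \<le> (\<integral>y. \<bar>g y - g x\<bar> \<partial>measure_pmf q)"
      by (rule integral_abs_bound)
    also have "\<dots> \<le> (\<integral>y. M * \<alpha> ^ m * (2 + V x + V y) \<partial>measure_pmf q)"
    proof (rule integral_mono)
      show "integrable (measure_pmf q) (\<lambda>y. \<bar>g y - g x\<bar>)"
        using int_g by simp
      show "integrable (measure_pmf q) (\<lambda>y. M * \<alpha> ^ m * (2 + V x + V y))"
        using moment_bound(1)[OF B(2,1)] by simp
      show "\<bar>g y - g x\<bar> \<le> M * \<alpha> ^ m * (2 + V x + V y)" for y
        using contr[of \<phi> n m x y, OF \<phi>] by (simp add: g_def abs_minus_commute)
    qed
    also have "\<dots> = M * \<alpha> ^ m * (2 + V x + (\<integral>y. V y \<partial>measure_pmf q))"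
      using moment_bound(1)[OF B(2,1)] by (simp add: measure_pmf.prob_space)
    also have "\<dots> \<le> M * \<alpha> ^ m * (2 + V x + B)"
      using \<alpha> M moment_bound(2)[OF B(2,1)] by (intro mult_left_mono) auto
    finally show "\<bar>(\<integral>z. \<phi> z \<partial>measure_pmf (bind_pmf q (\<lambda>y. P (n - int m) y n))) -
        (\<integral>z. \<phi> z \<partial>measure_pmf (P (n - int m) x n))\<bar> \<le> M * \<alpha> ^ m * (2 + V x + B)"
      by (simp add: g_def)
  qed
qed

section \<open>Attraction and uniqueness\<close>

text \<open>By invariance \<open>\<nu> n\<close> is the mixture started from
  \<open>\<nu> (n - int m)\<close>. As \<open>m\<close> varies the starting time moves into the
  past, so one bound \<open>B\<close> for all times keeps the constant independent of
  \<open>m\<close>.\<close>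

lemma geometrically_attracting_if_bounded_moments:
  assumes inv: "invariant_family P \<nu>" and B: "0 \<le> B"
    and bound: "\<And>n. (\<integral>\<^sup>+x. ennreal (V x) \<partial>measure_pmf (\<nu> n)) \<le> ennreal B"
  shows "geometrically_attracting P V \<nu>"
proof -
  obtain \<alpha> M where \<alpha>: "0 < \<alpha>" "\<alpha> < 1" and M: "0 < M" and contr:
    "\<And>m n x B (q :: 'a pmf) (\<phi> :: 'a \<Rightarrow> real). (\<And>x. \<bar>\<phi> x\<bar> \<le> 1) \<Longrightarrow> 0 \<le> B \<Longrightarrow>
      (\<integral>\<^sup>+y. ennreal (V y) \<partial>measure_pmf q) \<le> ennreal B \<Longrightarrow>
      \<bar>(\<integral>z. \<phi> z \<partial>measure_pmf (bind_pmf q (\<lambda>y. P (n - int m) y n))) -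
        (\<integral>z. \<phi> z \<partial>measure_pmf (P (n - int m) x n))\<bar> \<le> M * \<alpha> ^ m * (2 + V x + B)"
    using geometric_contraction_mixture by blast
  have "tv_norm_diff (P (n - int m) x n) (\<nu> n) \<le> M * (2 + B) * \<alpha> ^ m * (1 + V x)" for n m x
  proof -
    have "\<nu> n = bind_pmf (\<nu> (n - int m)) (\<lambda>y. P (n - int m) y n)"
      using inv by (simp add: invariant_family_def transition_op_def)
    then have "tv_norm_diff (P (n - int m) x n) (\<nu> n) \<le> M * \<alpha> ^ m * (2 + V x + B)"
      using contr[OF _ B bound[of "n - int m"]]
      by (intro tv_norm_diff_leI) (simp add: abs_minus_commute)
    also have "2 + V x + B \<le> (2 + B) * (1 + V x)"
      using B V_nonneg[of x] by (simp add: algebra_simps)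
    then have "M * \<alpha> ^ m * (2 + V x + B) \<le> M * \<alpha> ^ m * ((2 + B) * (1 + V x))"
      using \<alpha> M by (intro mult_left_mono) auto
    finally show ?thesis by (simp add: mult_ac)
  qed
  moreover have "0 < M * (2 + B)" using M B by simp
  ultimately show ?thesis
    unfolding geometrically_attracting_def using \<alpha> by blast
qed

lemma geometrically_attracting_tendsto:
  fixes \<phi> :: "'a \<Rightarrow> real"
  assumes "geometrically_attracting P V \<nu>" and "\<And>x. \<bar>\<phi> x\<bar> \<le> 1"
  shows "(\<lambda>m. \<integral>z. \<phi> z \<partial>measure_pmf (P (n - int m) x n)) \<longlonglongrightarrow> (\<integral>z. \<phi> z \<partial>measure_pmf (\<nu> n))"
proof -
  obtain \<alpha> M where \<alpha>: "0 < \<alpha>" "\<alpha> < 1"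
    and attr: "\<And>m. tv_norm_diff (P (n - int m) x n) (\<nu> n) \<le> M * \<alpha> ^ m * (1 + V x)"
    using assms(1) unfolding geometrically_attracting_def by blast
  have "(\<lambda>m. M * \<alpha> ^ m * (1 + V x)) \<longlonglongrightarrow> M * 0 * (1 + V x)"
    using \<alpha> by (intro tendsto_intros) auto
  then have lim: "(\<lambda>m. M * \<alpha> ^ m * (1 + V x)) \<longlonglongrightarrow> 0" by simp
  show ?thesis
    by (rule LIM_zero_cancel, rule Lim_null_comparison[OF always_eventually lim])
      (use order_trans[OF abs_integral_diff_le_tv_norm_diff[OF assms(2)] attr] in simp)
qed

text \<open>Both \<open>\<mu> n\<close> and \<open>\<nu> n\<close> are the limit of the laws at time
  \<open>n\<close> started ever earlier from one and the same point.\<close>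

lemma geometrically_attracting_unique:
  assumes "geometrically_attracting P V \<mu>" and "geometrically_attracting P V \<nu>"
  shows "\<mu> = \<nu>"
proof
  fix n
  show "\<mu> n = \<nu> n"
    using geometrically_attracting_tendsto[OF assms(1), of _ n undefined]
      geometrically_attracting_tendsto[OF assms(2), of _ n undefined]
    by (intro pmf_eq_if_integral_bounded_eq) (blast intro: LIMSEQ_unique)
qed

section \<open>Existence of the invariant family\<close>

text \<open>The family consists of the limits of the laws started ever earlier from a fixed point.
  Invariance passes to the limit because the transition operators preserve bounded test functions;
  the moment bound passes by Fatou.\<close>

lemma invariant_family_exists:
  obtains \<mu> B where "invariant_family P \<mu>" "0 \<le> B"
    "\<And>n. (\<integral>\<^sup>+x. ennreal (V x) \<partial>measure_pmf (\<mu> n)) \<le> ennreal B"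
proof -
  obtain \<alpha> M where \<alpha>: "0 < \<alpha>" "\<alpha> < 1" and M: "0 < M" and contr:
    "\<And>m n x B (q :: 'a pmf) (\<phi> :: 'a \<Rightarrow> real). (\<And>x. \<bar>\<phi> x\<bar> \<le> 1) \<Longrightarrow> 0 \<le> B \<Longrightarrow>
      (\<integral>\<^sup>+y. ennreal (V y) \<partial>measure_pmf q) \<le> ennreal B \<Longrightarrow>
      \<bar>(\<integral>z. \<phi> z \<partial>measure_pmf (bind_pmf q (\<lambda>y. P (n - int m) y n))) -
        (\<integral>z. \<phi> z \<partial>measure_pmf (P (n - int m) x n))\<bar> \<le> M * \<alpha> ^ m * (2 + V x + B)"
    using geometric_contraction_mixture by blast
  \<comment> \<open>An arbitrary starting point, kept fixed throughout.\<close>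
  define x :: 'a where "x = undefined"
  define B where "B = V x + K"
  define \<delta> where "\<delta> m = M * \<alpha> ^ m * (2 + V x + B)" for m
  have B: "0 \<le> B" using V_nonneg[of x] K_pos by (simp add: B_def)
  have "\<delta> \<longlonglongrightarrow> M * 0 * (2 + V x + B)"
    unfolding \<delta>_def using \<alpha> by (intro tendsto_intros) auto
  then have lim: "\<delta> \<longlonglongrightarrow> 0" by simp
  \<comment> \<open>A chain started \<open>j\<close> steps earlier is, from time
    \<open>n - int m\<close> on, a mixture whose starting law has \<open>V\<close>-moment at most
    \<open>B\<close>, whatever \<open>j\<close> is.\<close>
  have cauchy: "\<bar>(\<integral>z. \<phi> z \<partial>measure_pmf (P (n - int (m + j)) x n)) - (\<integral>z. \<phi> z \<partial>measure_pmf (P (n - int m) x n))\<bar> \<le> \<delta> m"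
    if \<phi>: "\<And>x. \<bar>\<phi> x\<bar> \<le> 1" for n m j and \<phi> :: "'a \<Rightarrow> real"
  proof -
    have eq: "n - int (m + j) = (n - int m) - int j" by simp
    show ?thesis
      unfolding eq \<delta>_def using P_bind[of "n - int m - int j" "n - int m" n x]
        contr[OF \<phi> B iterated_drift_uniform[of "n - int m" j x, folded B_def], where n = n and m = m and x = x]
      by simp
  qed
  have "\<forall>n. \<exists>q. (\<forall>m (\<phi> :: 'a \<Rightarrow> real). (\<forall>x. \<bar>\<phi> x\<bar> \<le> 1) \<longrightarrow>
      \<bar>(\<integral>z. \<phi> z \<partial>measure_pmf (P (n - int m) x n)) - (\<integral>z. \<phi> z \<partial>measure_pmf q)\<bar> \<le> \<delta> m) \<and>
      (\<forall>z. (\<lambda>m. pmf (P (n - int m) x n) z) \<longlonglongrightarrow> pmf q z)" (is "\<forall>n. \<exists>q. ?lim n q")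
  proof
    fix n
    show "\<exists>q. ?lim n q"
      by (rule pmf_Cauchy_limit[of "\<lambda>m. P (n - int m) x n", OF cauchy lim]) blast+
  qed
  from choice[OF this] obtain \<mu> where \<mu>: "\<forall>n. ?lim n (\<mu> n)" ..
  have near: "\<bar>(\<integral>z. \<phi> z \<partial>measure_pmf (P (n - int m) x n)) - (\<integral>z. \<phi> z \<partial>measure_pmf (\<mu> n))\<bar> \<le> \<delta> m"
    if "\<And>x. \<bar>\<phi> x\<bar> \<le> 1" for n m and \<phi> :: "'a \<Rightarrow> real"
    using \<mu> that by simp
  have pw: "(\<lambda>m. pmf (P (n - int m) x n) z) \<longlonglongrightarrow> pmf (\<mu> n) z" for n z
    using \<mu> by simp
  have weak: "(\<lambda>m. \<integral>z. \<phi> z \<partial>measure_pmf (P (n - int m) x n)) \<longlonglongrightarrow> (\<integral>z. \<phi> z \<partial>measure_pmf (\<mu> n))"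
    if "\<And>x. \<bar>\<phi> x\<bar> \<le> 1" for n and \<phi> :: "'a \<Rightarrow> real"
    by (rule LIM_zero_cancel, rule Lim_null_comparison[OF always_eventually lim])
      (use near[of \<phi>, OF that] in simp)
  show thesis
  proof (rule that[OF _ B])
    show "invariant_family P \<mu>"
      unfolding invariant_family_def transition_op_def
    proof (intro allI impI pmf_eq_if_integral_bounded_eq)
      fix k i :: int and \<phi> :: "'a \<Rightarrow> real" assume ki: "k \<le> i" and \<phi>: "\<And>x. \<bar>\<phi> x\<bar> \<le> 1"
      define g where "g y = (\<integral>z. \<phi> z \<partial>measure_pmf (P k y i))" for y
      have "\<bar>g y\<bar> \<le> 1" for y
        unfolding g_def by (rule abs_integral_pmf_le[OF \<phi>])
      then have "(\<lambda>m. \<integral>z. g z \<partial>measure_pmf (P (k - int m) x k)) \<longlonglongrightarrow> (\<integral>z. g z \<partial>measure_pmf (\<mu> k))"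
        by (rule weak)
      \<comment> \<open>The starting time \<open>k - int m\<close> lies
        \<open>m + nat (i - k)\<close> steps before \<open>i\<close>, so this is a shifted copy of
        the sequence converging to the integral under \<open>\<mu> i\<close>.\<close>
      moreover have "(\<integral>z. g z \<partial>measure_pmf (P (k - int m) x k)) =
          (\<integral>z. \<phi> z \<partial>measure_pmf (P (i - int (m + nat (i - k))) x i))" for m
        using ki P_bind[of "k - int m" k i x]
        by (simp add: g_def integral_bind_pmf_bounded[OF \<phi>])
      moreover have "(\<lambda>m. \<integral>z. \<phi> z \<partial>measure_pmf (P (i - int (m + nat (i - k))) x i)) \<longlonglongrightarrow>
          (\<integral>z. \<phi> z \<partial>measure_pmf (\<mu> i))"
        by (rule LIMSEQ_ignore_initial_segment[OF weak[OF \<phi>]])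
      ultimately show "(\<integral>z. \<phi> z \<partial>measure_pmf (bind_pmf (\<mu> k) (\<lambda>x. P k x i))) = (\<integral>z. \<phi> z \<partial>measure_pmf (\<mu> i))"
        by (simp add: integral_bind_pmf_bounded[OF \<phi>] g_def[symmetric] LIMSEQ_unique)
    qed
    fix n
    \<comment> \<open>\<open>V\<close> may be unbounded, so convergence on bounded test functions
      does not suffice; pointwise convergence of the weights with Fatou gives the
      inequality.\<close>
    have "(\<integral>\<^sup>+z. ennreal (V z) \<partial>measure_pmf (\<mu> n)) =
        (\<integral>\<^sup>+z. liminf (\<lambda>m. ennreal (pmf (P (n - int m) x n) z * V z)) \<partial>count_space UNIV)"
      unfolding nn_integral_measure_pmf
      by (intro nn_integral_cong, subst lim_imp_Liminf[OF _ tendsto_ennrealI])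
        (auto intro!: tendsto_intros pw simp: ennreal_mult V_nonneg)
    also have "\<dots> \<le> liminf (\<lambda>m. \<integral>\<^sup>+z. ennreal (pmf (P (n - int m) x n) z * V z) \<partial>count_space UNIV)"
      by (rule nn_integral_liminf) auto
    also have "\<dots> = liminf (\<lambda>m. \<integral>\<^sup>+z. ennreal (V z) \<partial>measure_pmf (P (n - int m) x n))"
      by (simp add: nn_integral_measure_pmf ennreal_mult V_nonneg)
    also have "\<dots> \<le> liminf (\<lambda>m. ennreal B)"
      unfolding B_def by (intro Liminf_mono always_eventually allI iterated_drift_uniform)
    also have "\<dots> = ennreal B" by (simp add: Liminf_const)
    finally show "(\<integral>\<^sup>+z. ennreal (V z) \<partial>measure_pmf (\<mu> n)) \<le> ennreal B" .
  qed
qed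

end

section \<open>Assembly of existence, attraction and uniqueness\<close>

theorem theorem4p3:
  fixes P :: "'a :: countable transition"
    and V :: "'a \<Rightarrow> real"
    and \<gamma> C :: real
  assumes "transition_probabilities P"
    and "\<And>x. 0 \<le> V x"
    and "0 < \<gamma>" and "\<gamma> < 1" and "0 < C"
    and "\<And>x n. (\<integral>\<^sup>+ y. ennreal (V y * pmf (P (n - 1) x n) y) \<partial>count_space UNIV)
                 \<le> ennreal (\<gamma> * V x + C)"
    and "\<And>R :: real. 0 < R \<Longrightarrow> uniformly_elliptic P {x. V x \<le> R}"
  shows "\<exists>\<mu> :: int \<Rightarrow> 'a pmf.
           invariant_family P \<mu> \<and>
           (\<forall>n. (\<integral>\<^sup>+ x. ennreal (V x) \<partial>measure_pmf (\<mu> n)) < \<infinity>) \<and>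
           geometrically_attracting P V \<mu> \<and>
           (\<forall>\<nu> :: int \<Rightarrow> 'a pmf.
              invariant_family P \<nu> \<and>
              (\<forall>n. (\<integral>\<^sup>+ x. ennreal (V x) \<partial>measure_pmf (\<nu> n)) < \<infinity>) \<and>
              (geometrically_attracting P V \<nu> \<or>
               (SUP n. \<integral>\<^sup>+ x. ennreal (V x) \<partial>measure_pmf (\<nu> n)) < \<infinity>)
              \<longrightarrow> \<nu> = \<mu>)"
proof -
  interpret harris_chain P V \<gamma> C
  proof
    show "(\<integral>\<^sup>+y. ennreal (V y) \<partial>measure_pmf (P (n - 1) x n)) \<le> ennreal (\<gamma> * V x + C)" for n x
      using assms(6)[where n = n and x = x] assms(2)
      by (simp add: nn_integral_measure_pmf ennreal_mult mult.commute)
  qed (use assms in auto)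
  obtain \<mu> B where inv: "invariant_family P \<mu>" and B: "0 \<le> B"
    and bound: "\<And>n. (\<integral>\<^sup>+x. ennreal (V x) \<partial>measure_pmf (\<mu> n)) \<le> ennreal B"
    using invariant_family_exists by blast
  have attr: "geometrically_attracting P V \<mu>"
    using geometrically_attracting_if_bounded_moments[OF inv B bound] .
  show ?thesis
  proof (intro exI[of _ \<mu>] conjI allI impI inv attr)
    show "(\<integral>\<^sup>+x. ennreal (V x) \<partial>measure_pmf (\<mu> n)) < \<infinity>" for n
      using le_less_trans[OF bound[of n] ennreal_less_top] by simp
    fix \<nu> :: "int \<Rightarrow> 'a pmf"
    assume \<nu>: "invariant_family P \<nu> \<and>
      (\<forall>n. (\<integral>\<^sup>+ x. ennreal (V x) \<partial>measure_pmf (\<nu> n)) < \<infinity>) \<and>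
      (geometrically_attracting P V \<nu> \<or>
       (SUP n. \<integral>\<^sup>+ x. ennreal (V x) \<partial>measure_pmf (\<nu> n)) < \<infinity>)"
    \<comment> \<open>Both alternatives reduce to attraction: a finite supremum of the moments
      supplies the uniform bound \<open>B'\<close>.\<close>
    have "geometrically_attracting P V \<nu>"
    proof (rule ccontr)
      assume not: "\<not> geometrically_attracting P V \<nu>"
      with \<nu> obtain B' where B': "0 \<le> B'" "(SUP n. \<integral>\<^sup>+ x. ennreal (V x) \<partial>measure_pmf (\<nu> n)) = ennreal B'"
        by (metis ennreal_cases infinity_ennreal_def less_irrefl)
      have "(\<integral>\<^sup>+ x. ennreal (V x) \<partial>measure_pmf (\<nu> n)) \<le> ennreal B'" for n
        unfolding B'(2)[symmetric] by (rule SUP_upper) simp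
      with geometrically_attracting_if_bounded_moments[of \<nu> B'] \<nu> B'(1) not show False by blast
    qed
    from geometrically_attracting_unique[OF this attr] show "\<nu> = \<mu>" .
  qed
qed

end
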